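(* Let $\lambda_1,\lambda_2,\lambda_3\in\mathbb{R}$ and let $\mathbb{K}$ be the associated algebra of 3-parameter generalized quaternions. Let $p\in S_{\mathbb{K}}$ be of the form $p=\cos\theta+\hat p\,\sin\theta$ with $\theta\in\mathbb{R}$ and $\hat p\in S^2_{\mathbb{K}}$. Then for every integer $n$, $$p^{n}=(\cos\theta+\hat p\sin\theta)^{n}=\cos(n\theta)+\hat p\,\sin(n\theta).$$
   Context: Given $\lambda_1,\lambda_2,\lambda_3\in\mathbb{R}$, $\mathbb{K}$ is the (associative, unital) real algebra with vector-space basis $1,e_1,e_2,e_3$, unit $1$, and bilinear multiplication determined by $e_1^2=-\lambda_1\lambda_2$, $e_2^2=-\lambda_1\lambda_3$, $e_3^2=-\lambda_2\lambda_3$, $e_1e_2=\lambda_1e_3=-e_2e_1$, $e_2e_3=\lambda_3e_1=-e_3e_2$, $e_3e_1=\lambda_2e_2=-e_1e_3$. For $p=a_0+a_1e_1+a_2e_2+a_3e_3\in\mathbb{K}$ (with $a_i\in\mathbb{R}$), the conjugate is $\bar p=a_0-a_1e_1-a_2e_2-a_3e_3$ and the norm is $N_p=p\bar p=a_0^2+\lambda_1\lambda_2a_1^2+\lambda_1\lambda_3a_2^2+\lambda_2\lambda_3a_3^2\in\mathbb{R}$. When $N_p\neq0$, $p$ is invertible with $p^{-1}=\bar p/N_p$, and negative powers are powers of $p^{-1}$. $\mathrm{Im}(\mathbb{K})=\{a_1e_1+a_2e_2+a_3e_3: a_i\in\mathbb{R}\}$, $S_{\mathbb{K}}=\{p\in\mathbb{K}:N_p=1\}$,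 $S^2_{\mathbb{K}}=\{h\in\mathrm{Im}(\mathbb{K}):N_h=1\}$. *)

theory Defs
  imports "HOL-Analysis.Analysis" "HOL-Algebra.Ring"
begin

text \<open>
  The tuple \<open>(a0, a1, a2, a3)\<close> stands for \<open>a0 + a1 e1 + a2 e2 + a3 e3\<close>. The real vector space
  structure is the library's one on products; only the multiplication depends on the parameters.
\<close>

type_synonym gquat = "real \<times> real \<times> real \<times> real"

definition gq_one :: gquat where "gq_one = (1, 0, 0, 0)"
definition gq_e1 :: gquat where "gq_e1 = (0, 1, 0, 0)"
definition gq_e2 :: gquat where "gq_e2 = (0, 0, 1, 0)"
definition gq_e3 :: gquat where "gq_e3 = (0, 0, 0, 1)"

text \<open>
  The bilinear extension of the multiplication table of the basis; see \<open>bilinear_gq_mult\<close> and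
  \<open>gq_mult_table\<close> below, which together determine it.
\<close>

fun gq_mult :: "real \<Rightarrow> real \<Rightarrow> real \<Rightarrow> gquat \<Rightarrow> gquat \<Rightarrow> gquat" where
  "gq_mult l1 l2 l3 (a0, a1, a2, a3) (b0, b1, b2, b3) =
    (a0 * b0 - l1 * l2 * a1 * b1 - l1 * l3 * a2 * b2 - l2 * l3 * a3 * b3,
     a0 * b1 + a1 * b0 + l3 * (a2 * b3 - a3 * b2),
     a0 * b2 + a2 * b0 + l2 * (a3 * b1 - a1 * b3),
     a0 * b3 + a3 * b0 + l1 * (a1 * b2 - a2 * b1))"

definition gq_algebra :: "real \<Rightarrow> real \<Rightarrow> real \<Rightarrow> gquat ring" where
  "gq_algebra l1 l2 l3 =
    \<lparr>carrier = UNIV, mult = gq_mult l1 l2 l3, one = gq_one, zero = 0, add = (+)\<rparr>"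

fun gq_cnj :: "gquat \<Rightarrow> gquat" where
  "gq_cnj (a0, a1, a2, a3) = (a0, - a1, - a2, - a3)"

fun gq_norm :: "real \<Rightarrow> real \<Rightarrow> real \<Rightarrow> gquat \<Rightarrow> real" where
  "gq_norm l1 l2 l3 (a0, a1, a2, a3) =
    a0\<^sup>2 + l1 * l2 * a1\<^sup>2 + l1 * l3 * a2\<^sup>2 + l2 * l3 * a3\<^sup>2"

definition gq_Im :: "gquat set" where
  "gq_Im = {a1 *\<^sub>R gq_e1 + a2 *\<^sub>R gq_e2 + a3 *\<^sub>R gq_e3 | a1 a2 a3. True}"

definition gq_sphere :: "real \<Rightarrow> real \<Rightarrow> real \<Rightarrow> gquat set" where
  "gq_sphere l1 l2 l3 = {p. gq_norm l1 l2 l3 p = 1}"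

definition gq_sphere2 :: "real \<Rightarrow> real \<Rightarrow> real \<Rightarrow> gquat set" where
  "gq_sphere2 l1 l2 l3 = {h \<in> gq_Im. gq_norm l1 l2 l3 h = 1}"

lemma bilinear_gq_mult: "bilinear (gq_mult l1 l2 l3)"
  unfolding bilinear_def
  by (auto intro!: linearI simp: algebra_simps)

lemma gq_mult_table:
  "gq_mult l1 l2 l3 gq_one x = x" "gq_mult l1 l2 l3 x gq_one = x"
  "gq_mult l1 l2 l3 gq_e1 gq_e1 = - (l1 * l2) *\<^sub>R gq_one"
  "gq_mult l1 l2 l3 gq_e2 gq_e2 = - (l1 * l3) *\<^sub>R gq_one"
  "gq_mult l1 l2 l3 gq_e3 gq_e3 = - (l2 * l3) *\<^sub>R gq_one"
  "gq_mult l1 l2 l3 gq_e1 gq_e2 = l1 *\<^sub>R gq_e3" "gq_mult l1 l2 l3 gq_e2 gq_e1 = - l1 *\<^sub>R gq_e3"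
  "gq_mult l1 l2 l3 gq_e2 gq_e3 = l3 *\<^sub>R gq_e1" "gq_mult l1 l2 l3 gq_e3 gq_e2 = - l3 *\<^sub>R gq_e1"
  "gq_mult l1 l2 l3 gq_e3 gq_e1 = l2 *\<^sub>R gq_e2" "gq_mult l1 l2 l3 gq_e1 gq_e3 = - l2 *\<^sub>R gq_e2"
  by (cases x; simp add: gq_one_def gq_e1_def gq_e2_def gq_e3_def)+

lemma gq_mult_assoc:
  "gq_mult l1 l2 l3 (gq_mult l1 l2 l3 x y) z = gq_mult l1 l2 l3 x (gq_mult l1 l2 l3 y z)"
  by (cases x; cases y; cases z) (simp add: algebra_simps)

lemma ring_gq_algebra: "ring (gq_algebra l1 l2 l3)"
proof (rule ringI)
  show "abelian_group (gq_algebra l1 l2 l3)"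
  proof (rule abelian_groupI)
    show "\<exists>y\<in>carrier (gq_algebra l1 l2 l3). y \<oplus>\<^bsub>gq_algebra l1 l2 l3\<^esub> x = \<zero>\<^bsub>gq_algebra l1 l2 l3\<^esub>" for x
      by (rule bexI[of _ "- x"]) (simp_all add: gq_algebra_def)
  qed (simp_all only: gq_algebra_def ring.simps partial_object.simps UNIV_I ac_simps add_0 add_0_right)
  show "Group.monoid (gq_algebra l1 l2 l3)"
    by (rule monoidI) (auto simp: gq_algebra_def gq_mult_table gq_mult_assoc)
qed (auto simp: gq_algebra_def bilinear_ladd[OF bilinear_gq_mult] bilinear_radd[OF bilinear_gq_mult])

lemma gq_mult_cnj:
  "gq_mult l1 l2 l3 p (gq_cnj p) = gq_norm l1 l2 l3 p *\<^sub>R gq_one"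
  "gq_mult l1 l2 l3 (gq_cnj p) p = gq_norm l1 l2 l3 p *\<^sub>R gq_one"
  by (cases p; simp add: gq_one_def power2_eq_square algebra_simps)+

text \<open>
  The ring-theoretic inverse, and hence the library's integer power in \<open>gq_algebra\<close>, is the one
  obtained from conjugate and norm.
\<close>

lemma gq_inv:
  assumes "gq_norm l1 l2 l3 p \<noteq> 0"
  shows "p \<in> Units (gq_algebra l1 l2 l3)"
    and "inv\<^bsub>gq_algebra l1 l2 l3\<^esub> p = (1 / gq_norm l1 l2 l3 p) *\<^sub>R gq_cnj p"
proof -
  interpret ring "gq_algebra l1 l2 l3" by (rule ring_gq_algebra)
  let ?q = "(1 / gq_norm l1 l2 l3 p) *\<^sub>R gq_cnj p"
  have 1: "p \<otimes>\<^bsub>gq_algebra l1 l2 l3\<^esub> ?q = \<one>\<^bsub>gq_algebra l1 l2 l3\<^esub>"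
    and 2: "?q \<otimes>\<^bsub>gq_algebra l1 l2 l3\<^esub> p = \<one>\<^bsub>gq_algebra l1 l2 l3\<^esub>"
    using assms
    by (simp_all add: gq_algebra_def bilinear_lmul[OF bilinear_gq_mult]
        bilinear_rmul[OF bilinear_gq_mult] gq_mult_cnj)
  have c: "x \<in> carrier (gq_algebra l1 l2 l3)" for x by (simp add: gq_algebra_def)
  show "p \<in> Units (gq_algebra l1 l2 l3)" unfolding Units_def using 1 2 c by blast
  show "inv\<^bsub>gq_algebra l1 l2 l3\<^esub> p = ?q" using inv_char[OF c c 1 2] .
qed

lemma gq_int_pow_neg:
  assumes "gq_norm l1 l2 l3 p \<noteq> 0"
  shows "p [^]\<^bsub>gq_algebra l1 l2 l3\<^esub> (- int k) =
    ((1 / gq_norm l1 l2 l3 p) *\<^sub>R gq_cnj p) [^]\<^bsub>gq_algebra l1 l2 l3\<^esub> k"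
proof -
  interpret ring "gq_algebra l1 l2 l3" by (rule ring_gq_algebra)
  let ?K = "gq_algebra l1 l2 l3"
  let ?q = "inv\<^bsub>?K\<^esub> p"
  have c: "x \<in> carrier ?K" for x by (simp add: gq_algebra_def)
  have u: "p \<in> Units ?K" by (rule gq_inv(1)[OF assms])
  have 1: "p [^]\<^bsub>?K\<^esub> k \<otimes>\<^bsub>?K\<^esub> ?q [^]\<^bsub>?K\<^esub> k = \<one>\<^bsub>?K\<^esub>"
    using pow_mult_distrib[of p ?q k] u c by simp
  have 2: "?q [^]\<^bsub>?K\<^esub> k \<otimes>\<^bsub>?K\<^esub> p [^]\<^bsub>?K\<^esub> k = \<one>\<^bsub>?K\<^esub>"
    using pow_mult_distrib[of ?q p k] u c by simp
  have "p [^]\<^bsub>?K\<^esub> (- int k) = ?q [^]\<^bsub>?K\<^esub> k"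
    using inv_char[OF c c 1 2] by (cases "k = 0") (simp_all add: int_pow_def2)
  then show ?thesis by (simp add: gq_inv(2)[OF assms])
qed

end

theory Submission
  imports Defs
begin

text \<open>
  A norm-one imaginary element \<open>h\<close> satisfies \<open>h h = - h (cnj h) = -1\<close>, so \<open>1\<close> and \<open>h\<close> span a
  copy of the complex numbers in which \<open>h\<close> plays the role of the imaginary unit. There
  \<open>cos t + h sin t\<close> is the analogue of \<open>cis t\<close>, and the addition formulas of sine and cosine
  say that it turns sums of angles into products (\<open>gq_cis_mult\<close>); natural powers follow by induction.
  For negative powers, the inverse of an element of norm one is its conjugate, which for
  \<open>cos t + h sin t\<close> is the element with angle \<open>- t\<close> (\<open>gq_cnj_cis\<close>), so they are natural powers
  again.
\<close>

definition gq_cis :: "gquat \<Rightarrow> real \<Rightarrow> gquat" where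
  "gq_cis h t = cos t *\<^sub>R gq_one + sin t *\<^sub>R h"

lemma gq_cnj_Im: "h \<in> gq_Im \<Longrightarrow> gq_cnj h = - h"
  by (auto simp: gq_Im_def gq_e1_def gq_e2_def gq_e3_def)

text \<open>Since \<open>h\<close> is imaginary, \<open>h h = - h (cnj h)\<close>, which is minus the norm of \<open>h\<close>.\<close>

lemma gq_mult_self_sphere2:
  assumes "h \<in> gq_sphere2 l1 l2 l3"
  shows "gq_mult l1 l2 l3 h h = - gq_one"
proof -
  have "h \<in> gq_Im" and "gq_norm l1 l2 l3 h = 1"
    using assms by (auto simp: gq_sphere2_def)
  then have "- gq_mult l1 l2 l3 h h = gq_one"
    using gq_mult_cnj(1)[of l1 l2 l3 h]
    by (simp add: gq_cnj_Im bilinear_rneg[OF bilinear_gq_mult])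
  then show ?thesis
    by (metis minus_minus)
qed

text \<open>
  With \<open>h h = -1\<close>, the product has the real part and the \<open>h\<close> part of a product of complex
  numbers of modulus one, which are those of the addition formulas.
\<close>

lemma gq_cis_mult:
  assumes "h \<in> gq_sphere2 l1 l2 l3"
  shows "gq_mult l1 l2 l3 (gq_cis h s) (gq_cis h t) = gq_cis h (s + t)"
proof -
  note bil = bilinear_gq_mult[of l1 l2 l3]
  have "gq_mult l1 l2 l3 (gq_cis h s) (gq_cis h t)
      = (cos s * cos t - sin s * sin t) *\<^sub>R gq_one + (sin s * cos t + cos s * sin t) *\<^sub>R h"
    by (simp add: gq_cis_def bilinear_ladd[OF bil] bilinear_radd[OF bil] bilinear_lmul[OF bil]
        bilinear_rmul[OF bil] gq_mult_table gq_mult_self_sphere2[OF assms] algebra_simps)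
  then show ?thesis
    by (simp add: gq_cis_def cos_add sin_add)
qed

lemma gq_cnj_cis: "h \<in> gq_Im \<Longrightarrow> gq_cnj (gq_cis h t) = gq_cis h (- t)"
  by (auto simp: gq_cis_def gq_one_def gq_Im_def gq_e1_def gq_e2_def gq_e3_def)

lemma gq_cis_nat_pow:
  assumes "h \<in> gq_sphere2 l1 l2 l3"
  shows "gq_cis h t [^]\<^bsub>gq_algebra l1 l2 l3\<^esub> (k :: nat) = gq_cis h (real k * t)"
proof (induction k)
  case 0
  show ?case by (simp add: gq_cis_def gq_algebra_def)
next
  case (Suc k)
  have "gq_cis h t [^]\<^bsub>gq_algebra l1 l2 l3\<^esub> Suc k
      = gq_mult l1 l2 l3 (gq_cis h t [^]\<^bsub>gq_algebra l1 l2 l3\<^esub> k) (gq_cis h t)"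
    by (simp add: gq_algebra_def)
  also have "\<dots> = gq_cis h (real (Suc k) * t)"
    by (simp add: Suc gq_cis_mult[OF assms] algebra_simps)
  finally show ?case .
qed

theorem theorem4p3:
  fixes l1 l2 l3 \<theta> :: real and p h :: gquat and n :: int
  assumes "p \<in> gq_sphere l1 l2 l3"
    and "h \<in> gq_sphere2 l1 l2 l3"
    and "p = cos \<theta> *\<^sub>R gq_one + sin \<theta> *\<^sub>R h"
  shows "p [^]\<^bsub>gq_algebra l1 l2 l3\<^esub> n
    = cos (of_int n * \<theta>) *\<^sub>R gq_one + sin (of_int n * \<theta>) *\<^sub>R h"
proof -
  have p: "p = gq_cis h \<theta>"
    using assms(3) by (simp add: gq_cis_def)
  have norm: "gq_norm l1 l2 l3 p = 1"
    using assms(1) by (simp add: gq_sphere_def)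
  have cnj: "gq_cnj p = gq_cis h (- \<theta>)"
    using assms(2) by (simp add: p gq_cnj_cis gq_sphere2_def)
  have "p [^]\<^bsub>gq_algebra l1 l2 l3\<^esub> n = gq_cis h (of_int n * \<theta>)"
  proof (cases n rule: int_cases2)
    case (nonneg k)
    then show ?thesis
      by (simp add: p int_pow_int gq_cis_nat_pow[OF assms(2)])
  next
    case (nonpos k)
    have "p [^]\<^bsub>gq_algebra l1 l2 l3\<^esub> n = gq_cis h (- \<theta>) [^]\<^bsub>gq_algebra l1 l2 l3\<^esub> k"
      using gq_int_pow_neg[of l1 l2 l3 p k] by (simp add: nonpos norm cnj)
    then show ?thesis
      by (simp add: nonpos gq_cis_nat_pow[OF assms(2)])
  qed
  then show ?thesis by (simp add: gq_cis_def)
qed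

end
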